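(* The posets $\mathit{ESubst}$ and $\mathit{Subst}_\sim$ are isomorphic.
   Context: Fix a first-order signature with at least one constant and one function symbol of arity $\ge 2$, and an infinite set $\mathcal V$ of variables; $\wp_f(\mathcal V)$ is the set of finite subsets of $\mathcal V$. *$\mathit{Subst}_\sim$.* A substitution is a map $\theta$ from $\mathcal V$ to terms with $\{x\mid\theta(x)\ne x\}$ finite, extended to terms; $\mathit{Subst}$ is the set of substitutions; a renaming is a substitution that is a bijection $\mathcal V\to\mathcal V$. For $U\in\wp_f(\mathcal V)$: $\theta_1\preceq_U\theta_2$ iff $\exists\delta\in\mathit{Subst}\ \forall u\in U.\ \theta_1(u)=\delta(\theta_2(u))$; $\theta_1\sim_U\theta_2$ iff there is a renaming $\rho$ with $\theta_1(u)=\rho(\theta_2(u))$ for all $u\in U$ (this is the equivalence relation induced by the preorder $\preceq_U$). $\mathit{Subst}_\sim$ is the disjoint union over $U\in\wp_f(\mathcal V)$ of the quotients $\mathit{Subst}/{\sim_U}$; writing $[\theta]_U$ for classes, it is partially ordered by $[\theta]_U\preceq[\theta']_V$ iff $U\supseteq V$ and $\theta\preceq_V\theta'$. *$\mathit{ESubst}$.* An E-substitution is a map $\sigma$ from a finite set of variables $\mathrm{dom}(\sigma)\subseteq\mathcal V$ to terms; its application to a term replaces each variable $x\in\mathrm{dom}(\sigma)$ by $\sigma(x)$ and leaves other variables unchanged. Preorder: $\sigma\le_E\theta$ iff $\mathrm{dom}(\theta)\subseteq\mathrm{dom}(\sigma)$ and, for every term $t$ with $\mathrm{vars}(t)\subseteq\mathrm{dom}(\theta)$,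 there is an E-substitution $\delta$ with $\sigma(t)=\delta(\theta(t))$. $\sim_E$ is the equivalence relation induced by $\le_E$, and $\mathit{ESubst}$ is the set of $\sim_E$-classes of E-substitutions with the partial order induced by $\le_E$. *)

theory Defs
  imports Main
begin

text \<open>
  A first-order signature is a type \<open>'f\<close> of function symbols with an arity function
  \<open>ar :: 'f \<Rightarrow> nat\<close> (constants are the symbols of arity 0); the variables are the elements of
  the type \<open>'v\<close>. The datatype ignores arities, and \<open>terms ar\<close> is the set of terms over the
  signature.
\<close>

datatype (funs_trm: 'f, vars_trm: 'v) trm =
  Var 'v | Fun 'f "('f, 'v) trm list"

inductive_set "terms" :: "('f \<Rightarrow> nat) \<Rightarrow> ('f, 'v) trm set" for ar :: "'f \<Rightarrow> nat" where
  Var: "Var x \<in> terms ar"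
| Fun: "length ts = ar f \<Longrightarrow> (\<forall>t \<in> set ts. t \<in> terms ar) \<Longrightarrow> Fun f ts \<in> terms ar"

primrec subst_apply :: "('v \<Rightarrow> ('f, 'v) trm) \<Rightarrow> ('f, 'v) trm \<Rightarrow> ('f, 'v) trm" where
  "subst_apply \<theta> (Var x) = \<theta> x"
| "subst_apply \<theta> (Fun f ts) = Fun f (map (subst_apply \<theta>) ts)"


definition Subst :: "('f \<Rightarrow> nat) \<Rightarrow> ('v \<Rightarrow> ('f, 'v) trm) set" where
  "Subst ar = {\<theta>. (\<forall>x. \<theta> x \<in> terms ar) \<and> finite {x. \<theta> x \<noteq> Var x}}"

text \<open>Variables are identified with the terms in \<open>range Var\<close>.\<close>

definition renamings :: "('f \<Rightarrow> nat) \<Rightarrow> ('v \<Rightarrow> ('f, 'v) trm) set" where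
  "renamings ar = {\<rho> \<in> Subst ar. bij_betw \<rho> UNIV (range Var)}"

definition subst_le ::
  "('f \<Rightarrow> nat) \<Rightarrow> 'v set \<Rightarrow> (('v \<Rightarrow> ('f, 'v) trm) \<times> ('v \<Rightarrow> ('f, 'v) trm)) set" where
  "subst_le ar U = {(\<theta>\<^sub>1, \<theta>\<^sub>2). \<theta>\<^sub>1 \<in> Subst ar \<and> \<theta>\<^sub>2 \<in> Subst ar \<and>
     (\<exists>\<delta> \<in> Subst ar. \<forall>u \<in> U. \<theta>\<^sub>1 u = subst_apply \<delta> (\<theta>\<^sub>2 u))}"

definition subst_sim ::
  "('f \<Rightarrow> nat) \<Rightarrow> 'v set \<Rightarrow> (('v \<Rightarrow> ('f, 'v) trm) \<times> ('v \<Rightarrow> ('f, 'v) trm)) set" where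
  "subst_sim ar U = {(\<theta>\<^sub>1, \<theta>\<^sub>2). \<theta>\<^sub>1 \<in> Subst ar \<and> \<theta>\<^sub>2 \<in> Subst ar \<and>
     (\<exists>\<rho> \<in> renamings ar. \<forall>u \<in> U. \<theta>\<^sub>1 u = subst_apply \<rho> (\<theta>\<^sub>2 u))}"

text \<open>The class of \<open>\<theta>\<close> with respect to \<open>U\<close> is the pair \<open>(U, subst_sim ar U `` {\<theta>})\<close>; the first
  component makes the union of the quotients disjoint.\<close>

definition Subst_sim :: "('f \<Rightarrow> nat) \<Rightarrow> ('v set \<times> ('v \<Rightarrow> ('f, 'v) trm) set) set" where
  "Subst_sim ar = (SIGMA U : {U. finite U}. Subst ar // subst_sim ar U)"

definition Subst_sim_le ::
  "('f \<Rightarrow> nat) \<Rightarrow>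
   (('v set \<times> ('v \<Rightarrow> ('f, 'v) trm) set) \<times> ('v set \<times> ('v \<Rightarrow> ('f, 'v) trm) set)) set" where
  "Subst_sim_le ar =
     {((U, subst_sim ar U `` {\<theta>}), (V, subst_sim ar V `` {\<theta>'})) | U V \<theta> \<theta>'.
        finite U \<and> finite V \<and> U \<supseteq> V \<and> (\<theta>, \<theta>') \<in> subst_le ar V}"


text \<open>E-substitutions are partial maps with finite domain.\<close>

definition esubsts :: "('f \<Rightarrow> nat) \<Rightarrow> ('v \<rightharpoonup> ('f, 'v) trm) set" where
  "esubsts ar = {\<sigma>. finite (dom \<sigma>) \<and> ran \<sigma> \<subseteq> terms ar}"

definition esubst_apply :: "('v \<rightharpoonup> ('f, 'v) trm) \<Rightarrow> ('f, 'v) trm \<Rightarrow> ('f, 'v) trm" where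
  "esubst_apply \<sigma> = subst_apply (\<lambda>x. case \<sigma> x of None \<Rightarrow> Var x | Some s \<Rightarrow> s)"

definition esubst_le ::
  "('f \<Rightarrow> nat) \<Rightarrow> (('v \<rightharpoonup> ('f, 'v) trm) \<times> ('v \<rightharpoonup> ('f, 'v) trm)) set" where
  "esubst_le ar = {(\<sigma>, \<theta>). \<sigma> \<in> esubsts ar \<and> \<theta> \<in> esubsts ar \<and> dom \<theta> \<subseteq> dom \<sigma> \<and>
     (\<forall>t \<in> terms ar. vars_trm t \<subseteq> dom \<theta> \<longrightarrow>
        (\<exists>\<delta> \<in> esubsts ar. esubst_apply \<sigma> t = esubst_apply \<delta> (esubst_apply \<theta> t)))}"

definition esubst_sim ::
  "('f \<Rightarrow> nat) \<Rightarrow> (('v \<rightharpoonup> ('f, 'v) trm) \<times> ('v \<rightharpoonup> ('f, 'v) trm)) set" where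
  "esubst_sim ar = esubst_le ar \<inter> (esubst_le ar)\<inverse>"

definition ESubst :: "('f \<Rightarrow> nat) \<Rightarrow> ('v \<rightharpoonup> ('f, 'v) trm) set set" where
  "ESubst ar = esubsts ar // esubst_sim ar"

definition ESubst_le ::
  "('f \<Rightarrow> nat) \<Rightarrow> (('v \<rightharpoonup> ('f, 'v) trm) set \<times> ('v \<rightharpoonup> ('f, 'v) trm) set) set" where
  "ESubst_le ar = {(esubst_sim ar `` {\<sigma>}, esubst_sim ar `` {\<theta>}) | \<sigma> \<theta>. (\<sigma>, \<theta>) \<in> esubst_le ar}"


text \<open>Isomorphism of the posets \<open>(A, r)\<close> and \<open>(B, s)\<close>. That both are posets is part of the
  definition.\<close>

definition isomorphic_posets ::
  "'a set \<Rightarrow> ('a \<times> 'a) set \<Rightarrow> 'b set \<Rightarrow> ('b \<times> 'b) set \<Rightarrow> bool" where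
  "isomorphic_posets A r B s \<longleftrightarrow> partial_order_on A r \<and> partial_order_on B s \<and>
     (\<exists>h. bij_betw h A B \<and> (\<forall>x \<in> A. \<forall>y \<in> A. (x, y) \<in> r \<longleftrightarrow> (h x, h y) \<in> s))"

end

theory Submission
  imports Defs
begin

text \<open>
  Since a finite set of variables is the variable set of a single term, the substitutions \<open>\<delta>\<close>
  witnessing \<open>\<sigma> \<le>\<^sub>E \<theta>\<close> term by term can be chosen uniformly, so \<open>\<sigma> \<le>\<^sub>E \<theta>\<close> holds iff
  \<open>dom \<theta> \<subseteq> dom \<sigma>\<close> and the extensions of \<open>\<sigma>\<close> and \<open>\<theta>\<close> by the identity are related by
  \<open>\<preceq>\<close> on \<open>dom \<theta>\<close>. On the other side, two mutually inverse instantiations act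
  as a bijection between finite sets of variables, which extends to a finitely supported permutation;
  hence \<open>\<sim>\<^sub>U\<close> is the equivalence induced by \<open>\<preceq>\<^sub>U\<close>. The isomorphism sends the class of \<open>\<sigma>\<close> to the
  class of its extension with respect to \<open>dom \<sigma>\<close>; restriction to \<open>U\<close> gives surjectivity.
\<close>

section \<open>Preorders, their quotients, and isomorphisms of quotients\<close>

lemma preorder_on_pullback:
  assumes s: "preorder_on B s" and r: "r \<subseteq> A \<times> A" and f: "f ` A \<subseteq> B"
    and rs: "\<And>x y. x \<in> A \<Longrightarrow> y \<in> A \<Longrightarrow> (x, y) \<in> r \<longleftrightarrow> (f x, f y) \<in> s"
  shows "preorder_on A r"
  unfolding preorder_on_def
proof (intro conjI r)
  show "refl_on A r" using s f rs by (auto simp: refl_on_def preorder_on_def)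
  show "trans r"
  proof (rule transI)
    fix x y z assume "(x, y) \<in> r" "(y, z) \<in> r"
    moreover from this have A: "x \<in> A" "y \<in> A" "z \<in> A" using r by auto
    ultimately have "(f x, f y) \<in> s" "(f y, f z) \<in> s" using rs by auto
    then have "(f x, f z) \<in> s" using s by (auto simp: preorder_on_def dest: transD)
    then show "(x, z) \<in> r" using A rs by simp
  qed
qed

text \<open>Other representatives of the two classes are \<open>q\<close>-equivalent to
  \<open>x\<close> and \<open>y\<close>, so transitivity carries the relation over. Here
  \<open>k\<close> may be any map whose fibres on \<open>C\<close> are the classes of the
  equivalence induced by \<open>q\<close>.\<close>

lemma quotient_le_iff:
  assumes q: "preorder_on C q"
    and k: "\<And>x y. x \<in> C \<Longrightarrow> y \<in> C \<Longrightarrow> k x = k y \<longleftrightarrow> (x, y) \<in> q \<and> (y, x) \<in> q"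
    and "x \<in> C" "y \<in> C"
  shows "(k x, k y) \<in> {(k x, k y) | x y. (x, y) \<in> q} \<longleftrightarrow> (x, y) \<in> q"
proof
  assume "(k x, k y) \<in> {(k x, k y) | x y. (x, y) \<in> q}"
  then obtain x' y' where *: "k x = k x'" "k y = k y'" "(x', y') \<in> q" by auto
  moreover have "x' \<in> C" "y' \<in> C" using q *(3) by (auto simp: preorder_on_def)
  ultimately have "(x, x') \<in> q" "(y', y) \<in> q" using k assms(3,4) by blast+
  then show "(x, y) \<in> q" using *(3) q by (auto simp: preorder_on_def dest: transD)
qed blast

lemma partial_order_on_quotient:
  assumes q: "preorder_on C q"
    and k: "\<And>x y. x \<in> C \<Longrightarrow> y \<in> C \<Longrightarrow> k x = k y \<longleftrightarrow> (x, y) \<in> q \<and> (y, x) \<in> q"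
  shows "partial_order_on (k ` C) {(k x, k y) | x y. (x, y) \<in> q}" (is "partial_order_on _ ?q")
proof -
  have iff: "(k x, k y) \<in> ?q \<longleftrightarrow> (x, y) \<in> q" if "x \<in> C" "y \<in> C" for x y
    by (rule quotient_le_iff[OF q k that])
  have sub: "q \<subseteq> C \<times> C" and refl: "\<And>x. x \<in> C \<Longrightarrow> (x, x) \<in> q" and tr: "trans q"
    using q by (auto simp: preorder_on_def refl_on_def)
  have "?q \<subseteq> k ` C \<times> k ` C" using sub by auto
  moreover have "refl_on (k ` C) ?q" using refl by (auto simp: refl_on_def)
  moreover have "trans ?q"
  proof (rule transI)
    fix a b e assume *: "(a, b) \<in> ?q" "(b, e) \<in> ?q"
    then obtain x y z where abe: "a = k x" "b = k y" "e = k z" and C: "x \<in> C" "y \<in> C" "z \<in> C"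
      using sub by blast
    have "(x, y) \<in> q" "(y, z) \<in> q"
      using * C unfolding abe by (simp_all only: iff)
    then show "(a, e) \<in> ?q" using abe tr by (blast dest: transD)
  qed
  moreover have "antisym ?q"
  proof (rule antisymI)
    fix a b assume *: "(a, b) \<in> ?q" "(b, a) \<in> ?q"
    then obtain x y where ab: "a = k x" "b = k y" and C: "x \<in> C" "y \<in> C"
      using sub by blast
    have "(x, y) \<in> q" "(y, x) \<in> q"
      using * C unfolding ab by (simp_all only: iff)
    then show "a = b" using ab C k by simp
  qed
  ultimately show ?thesis by (simp add: partial_order_on_def preorder_on_def)
qed

text \<open>Leaving the class maps \<open>c\<close> and \<open>d\<close> abstract admits classes
  tagged with a variable set. Since \<open>f\<close> preserves and reflects the preorders, it
  induces an injection on classes; it need only reach each element of \<open>B\<close> up to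
  equivalence.\<close>

lemma isomorphic_posets_of_preorders:
  assumes r: "preorder_on A r" and s: "preorder_on B s"
    and f: "f ` A \<subseteq> B"
    and rs: "\<And>x y. x \<in> A \<Longrightarrow> y \<in> A \<Longrightarrow> (x, y) \<in> r \<longleftrightarrow> (f x, f y) \<in> s"
    and c: "\<And>x y. x \<in> A \<Longrightarrow> y \<in> A \<Longrightarrow> c x = c y \<longleftrightarrow> (x, y) \<in> r \<and> (y, x) \<in> r"
    and d: "\<And>x y. x \<in> B \<Longrightarrow> y \<in> B \<Longrightarrow> d x = d y \<longleftrightarrow> (x, y) \<in> s \<and> (y, x) \<in> s"
    and surj: "\<And>y. y \<in> B \<Longrightarrow> \<exists>x \<in> A. d (f x) = d y"
  shows "isomorphic_posets (c ` A) {(c x, c y) | x y. (x, y) \<in> r}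
    (d ` B) {(d x, d y) | x y. (x, y) \<in> s}" (is "isomorphic_posets _ ?r _ ?s")
proof -
  have fB: "f x \<in> B" if "x \<in> A" for x using f that by blast
  have dc: "d (f x) = d (f y) \<longleftrightarrow> c x = c y" if "x \<in> A" "y \<in> A" for x y
    using that c d rs fB by simp
  \<comment> \<open>The representative chosen by \<open>inv_into\<close> is arbitrary;
    \<open>dc\<close> makes the value independent of the choice.\<close>
  define h where "h a = d (f (inv_into A c a))" for a
  have h: "h (c x) = d (f x)" if "x \<in> A" for x
    using that dc by (simp add: h_def f_inv_into_f inv_into_into)
  have "inj_on h (c ` A)" using h dc by (auto simp: inj_on_def)
  moreover have "h ` c ` A = d ` B"
  proof
    show "h ` c ` A \<subseteq> d ` B" using h fB by auto
    show "d ` B \<subseteq> h ` c ` A"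
    proof
      fix e assume "e \<in> d ` B"
      then obtain x where "x \<in> A" "d (f x) = e" using surj by blast
      then show "e \<in> h ` c ` A" using h by force
    qed
  qed
  ultimately have "bij_betw h (c ` A) (d ` B)" by (simp add: bij_betw_def)
  moreover have "(c x, c y) \<in> ?r \<longleftrightarrow> (h (c x), h (c y)) \<in> ?s" if "x \<in> A" "y \<in> A" for x y
  proof -
    have "(c x, c y) \<in> ?r \<longleftrightarrow> (x, y) \<in> r" by (rule quotient_le_iff[OF r c that])
    also have "\<dots> \<longleftrightarrow> (f x, f y) \<in> s" using that by (rule rs)
    also have "\<dots> \<longleftrightarrow> (d (f x), d (f y)) \<in> ?s"
      by (rule quotient_le_iff[OF s d fB[OF that(1)] fB[OF that(2)], symmetric])
    finally show ?thesis using that by (simp only: h)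
  qed
  then have "\<forall>a \<in> c ` A. \<forall>b \<in> c ` A. (a, b) \<in> ?r \<longleftrightarrow> (h a, h b) \<in> ?s"
    by (simp only: ball_simps) blast
  moreover have "partial_order_on (c ` A) ?r" by (intro partial_order_on_quotient r c)
  moreover have "partial_order_on (d ` B) ?s" by (intro partial_order_on_quotient s d)
  ultimately show ?thesis unfolding isomorphic_posets_def by blast
qed

section \<open>Application and composition of substitutions\<close>

lemma subst_apply_eq_iff:
  "subst_apply \<sigma> t = subst_apply \<tau> t \<longleftrightarrow> (\<forall>x \<in> vars_trm t. \<sigma> x = \<tau> x)"
  by (induction t) auto

lemma subst_apply_subst_apply:
  "subst_apply \<sigma> (subst_apply \<tau> t) = subst_apply (\<lambda>x. subst_apply \<sigma> (\<tau> x)) t"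
  by (induction t) auto

lemma subst_apply_Var: "subst_apply Var t = t"
  by (induction t) (auto simp: map_idI)

lemma subst_apply_terms:
  assumes "t \<in> terms ar" and "\<And>x. \<theta> x \<in> terms ar"
  shows "subst_apply \<theta> t \<in> terms ar"
  using assms(1) by induction (auto intro!: terms.intros assms(2))

lemma finite_vars_trm: "finite (vars_trm t)"
  by (induction t) auto

lemma Var_in_Subst: "Var \<in> Subst ar"
  by (auto simp: Subst_def intro: terms.intros)

lemma comp_in_Subst:
  assumes "\<sigma> \<in> Subst ar" "\<tau> \<in> Subst ar"
  shows "(\<lambda>x. subst_apply \<sigma> (\<tau> x)) \<in> Subst ar"
proof -
  have "{x. subst_apply \<sigma> (\<tau> x) \<noteq> Var x} \<subseteq> {x. \<sigma> x \<noteq> Var x} \<union> {x. \<tau> x \<noteq> Var x}" by auto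
  then show ?thesis
    using assms unfolding Subst_def by (auto intro: subst_apply_terms dest: finite_subset)
qed

section \<open>Renamings as finitely supported permutations of the variables\<close>

lemma Var_bij_in_renamings:
  fixes ar :: "'f \<Rightarrow> nat" and p :: "'v \<Rightarrow> 'v"
  assumes "bij p" "finite {x. p x \<noteq> x}"
  shows "(\<lambda>x. Var (p x) :: ('f, 'v) trm) \<in> renamings ar"
proof -
  have "bij_betw (Var :: 'v \<Rightarrow> ('f, 'v) trm) UNIV (range Var)"
    by (simp add: bij_betw_def inj_on_def)
  with assms(1) have "bij_betw (Var \<circ> p :: 'v \<Rightarrow> ('f, 'v) trm) UNIV (range Var)"
    by (rule bij_betw_trans)
  then show ?thesis
    using assms(2) by (simp add: renamings_def Subst_def terms.intros comp_def)
qed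

text \<open>The values of a renaming are variables, so it factors through \<open>Var\<close>, and
  the factor inherits bijectivity and finite support.\<close>

lemma renaming_obtain_bij:
  assumes "\<rho> \<in> renamings ar"
  obtains p where "bij p" "finite {x. p x \<noteq> x}" "\<rho> = (\<lambda>x. Var (p x))"
proof -
  have b: "bij_betw \<rho> UNIV (range Var)" and fin: "finite {x. \<rho> x \<noteq> Var x}"
    using assms by (auto simp: renamings_def Subst_def)
  have "\<forall>x. \<exists>y. \<rho> x = Var y" using b by (auto simp: bij_betw_def)
  then obtain p where p: "\<And>x. \<rho> x = Var (p x)" by metis
  have "inj p" using b p by (auto simp: bij_betw_def inj_on_def)
  moreover have "surj p"
  proof (rule surjI)
    fix y
    have "Var y \<in> range \<rho>" using b by (auto simp: bij_betw_def)
    then show "p (SOME x. p x = y) = y"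
      using p by (auto intro: someI)
  qed
  ultimately show thesis using that fin p by (auto simp: bij_def)
qed

lemma renaming_inverse:
  assumes "\<rho> \<in> renamings ar"
  obtains \<rho>' where "\<rho>' \<in> renamings ar" "\<And>t. subst_apply \<rho>' (subst_apply \<rho> t) = t"
proof -
  from assms obtain p where p: "bij p" "finite {x. p x \<noteq> x}" "\<rho> = (\<lambda>x. Var (p x))"
    by (rule renaming_obtain_bij)
  \<comment> \<open>A fixed point of \<open>p\<close> is also fixed by its inverse, so the support
    does not grow.\<close>
  have "{x. inv p x \<noteq> x} \<subseteq> {x. p x \<noteq> x}"
    using p(1) by (auto dest: bij_inv_eq_iff[THEN iffD2, of p, OF _ sym])
  with p have "(\<lambda>x. Var (inv p x)) \<in> renamings ar"
    by (intro Var_bij_in_renamings) (auto intro: bij_imp_bij_inv finite_subset)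
  moreover have "subst_apply (\<lambda>x. Var (inv p x)) (subst_apply \<rho> t) = t" for t
    using p by (simp add: subst_apply_subst_apply bij_def subst_apply_Var)
  ultimately show thesis by (rule that)
qed

text \<open>\<open>W\<close> and its image under \<open>g\<close> have the same size, hence so do
  their complements in the union of both. A bijection between these complements completes
  \<open>g\<close> to a permutation of the union; outside it the identity is used.\<close>

lemma finite_inj_extends_to_bij:
  fixes g :: "'v \<Rightarrow> 'v"
  assumes W: "finite W" and g: "inj_on g W"
  obtains p where "bij p" "finite {x. p x \<noteq> x}" "\<And>x. x \<in> W \<Longrightarrow> p x = g x"
proof -
  let ?C = "W \<union> g ` W"
  have "card (?C - W) = card (?C - g ` W)"
    using W g by (simp add: card_Diff_subset card_image)
  with W obtain k where k: "bij_betw k (?C - W) (?C - g ` W)"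
    by (meson finite_Diff finite_UnI finite_imageI finite_same_card_bij)
  define p where "p x = (if x \<in> W then g x else if x \<in> ?C then k x else x)" for x
  have "bij_betw p W (g ` W)"
    using g by (simp add: bij_betw_def p_def inj_on_def)
  moreover have "bij_betw p (?C - W) (?C - g ` W)"
    using k by (rule bij_betw_cong[THEN iffD1, rotated]) (auto simp: p_def)
  ultimately have "bij_betw p (W \<union> (?C - W)) (g ` W \<union> (?C - g ` W))"
    by (rule bij_betw_combine) auto
  then have "bij_betw p ?C ?C" by (simp add: Un_ac)
  moreover have "bij_betw p (- ?C) (- ?C)"
    using bij_betw_id by (rule bij_betw_cong[THEN iffD1, rotated]) (simp add: p_def)
  ultimately have "bij_betw p (?C \<union> - ?C) (?C \<union> - ?C)"
    by (rule bij_betw_combine) auto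
  then have "bij p" by (simp only: Compl_partition)
  moreover have "{x. p x \<noteq> x} \<subseteq> ?C" by (auto simp: p_def)
  then have "finite {x. p x \<noteq> x}" using W by (auto intro: finite_subset)
  ultimately show thesis using that by (simp add: p_def)
qed

section \<open>The instantiation preorder and the equivalence it induces\<close>

lemma subst_le_refl: "\<theta> \<in> Subst ar \<Longrightarrow> (\<theta>, \<theta>) \<in> subst_le ar U"
  using Var_in_Subst by (force simp: subst_le_def subst_apply_Var)

text \<open>Two variable sets are allowed because the order on \<open>Subst_sim\<close> compares
  classes over different sets. The witnesses compose since both equations are available on the
  smaller set \<open>V\<close>.\<close>

lemma subst_le_trans:
  assumes "(\<theta>\<^sub>1, \<theta>\<^sub>2) \<in> subst_le ar U" "(\<theta>\<^sub>2, \<theta>\<^sub>3) \<in> subst_le ar V" "V \<subseteq> U"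
  shows "(\<theta>\<^sub>1, \<theta>\<^sub>3) \<in> subst_le ar V"
proof -
  obtain \<delta> \<epsilon> where "\<delta> \<in> Subst ar" "\<epsilon> \<in> Subst ar"
    "\<forall>u \<in> U. \<theta>\<^sub>1 u = subst_apply \<delta> (\<theta>\<^sub>2 u)" "\<forall>u \<in> V. \<theta>\<^sub>2 u = subst_apply \<epsilon> (\<theta>\<^sub>3 u)"
    using assms(1,2) by (auto simp: subst_le_def)
  with assms show ?thesis
    by (auto simp: subst_le_def subst_apply_subst_apply subset_iff
        intro!: bexI[where x = "\<lambda>x. subst_apply \<delta> (\<epsilon> x)"] comp_in_Subst)
qed

text \<open>A renaming and its inverse witness the two instantiations. Conversely,
  \<open>\<epsilon>\<close> undoes \<open>\<delta>\<close> on the variables of the terms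
  \<open>\<theta>\<^sub>2 u\<close>, so there \<open>\<delta>\<close> is an injection into the
  variables, and finiteness of \<open>U\<close> lets it be extended to a renaming.\<close>

lemma subst_sim_eq:
  assumes "finite U"
  shows "subst_sim ar U = subst_le ar U \<inter> (subst_le ar U)\<inverse>"
proof (intro set_eqI iffI; clarify)
  fix \<theta>\<^sub>1 \<theta>\<^sub>2 assume "(\<theta>\<^sub>1, \<theta>\<^sub>2) \<in> subst_sim ar U"
  then obtain \<rho> where S: "\<theta>\<^sub>1 \<in> Subst ar" "\<theta>\<^sub>2 \<in> Subst ar" and \<rho>: "\<rho> \<in> renamings ar"
    and eq: "\<forall>u \<in> U. \<theta>\<^sub>1 u = subst_apply \<rho> (\<theta>\<^sub>2 u)"
    by (auto simp: subst_sim_def)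
  from \<rho> obtain \<rho>' where \<rho>': "\<rho>' \<in> renamings ar" "\<And>t. subst_apply \<rho>' (subst_apply \<rho> t) = t"
    using renaming_inverse by blast
  then have "\<forall>u \<in> U. \<theta>\<^sub>2 u = subst_apply \<rho>' (\<theta>\<^sub>1 u)" using eq by simp
  then show "(\<theta>\<^sub>1, \<theta>\<^sub>2) \<in> subst_le ar U \<inter> (subst_le ar U)\<inverse>"
    using S \<rho> \<rho>'(1) eq unfolding subst_le_def renamings_def by blast
next
  fix \<theta>\<^sub>1 \<theta>\<^sub>2 assume "(\<theta>\<^sub>1, \<theta>\<^sub>2) \<in> subst_le ar U" "(\<theta>\<^sub>2, \<theta>\<^sub>1) \<in> subst_le ar U"
  then obtain \<delta> \<epsilon> where S: "\<theta>\<^sub>1 \<in> Subst ar" "\<theta>\<^sub>2 \<in> Subst ar"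
    and \<delta>: "\<forall>u \<in> U. \<theta>\<^sub>1 u = subst_apply \<delta> (\<theta>\<^sub>2 u)"
    and \<epsilon>: "\<forall>u \<in> U. \<theta>\<^sub>2 u = subst_apply \<epsilon> (\<theta>\<^sub>1 u)"
    unfolding subst_le_def by blast
  \<comment> \<open>Only the values of \<open>\<delta>\<close> on \<open>W\<close> affect the
    instances of the terms \<open>\<theta>\<^sub>2 u\<close>, so \<open>\<delta>\<close> may be
    replaced by any renaming that agrees with it there.\<close>
  define W where "W = (\<Union>u \<in> U. vars_trm (\<theta>\<^sub>2 u))"
  have inv: "subst_apply \<epsilon> (\<delta> x) = Var x" if "x \<in> W" for x
  proof -
    from that obtain u where u: "u \<in> U" "x \<in> vars_trm (\<theta>\<^sub>2 u)" by (auto simp: W_def)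
    \<comment> \<open>The composite reproduces \<open>\<theta>\<^sub>2 u\<close>, as the identity
      does; substitutions with the same effect on a term agree on its variables.\<close>
    then have "subst_apply (\<lambda>x. subst_apply \<epsilon> (\<delta> x)) (\<theta>\<^sub>2 u) = subst_apply Var (\<theta>\<^sub>2 u)"
      using \<delta> \<epsilon> by (metis subst_apply_subst_apply subst_apply_Var)
    with u show ?thesis by (simp add: subst_apply_eq_iff)
  qed
  \<comment> \<open>Applying a substitution to a compound term never yields a variable.\<close>
  have "\<exists>y. \<delta> x = Var y" if "x \<in> W" for x
    using inv[OF that] by (cases "\<delta> x") auto
  then obtain g where g: "\<And>x. x \<in> W \<Longrightarrow> \<delta> x = Var (g x)" by metis
  have "finite W" using assms by (simp add: W_def finite_vars_trm)
  moreover have "inj_on g W" 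
  proof (rule inj_onI)
    fix x y assume "x \<in> W" "y \<in> W" "g x = g y"
    then show "x = y" using inv[of x] inv[of y] g by simp
  qed
  ultimately obtain p where p: "bij p" "finite {x. p x \<noteq> x}" "\<And>x. x \<in> W \<Longrightarrow> p x = g x"
    using finite_inj_extends_to_bij[of W g] by blast
  have "\<theta>\<^sub>1 u = subst_apply (\<lambda>x. Var (p x)) (\<theta>\<^sub>2 u)" if u: "u \<in> U" for u
  proof -
    have "subst_apply \<delta> (\<theta>\<^sub>2 u) = subst_apply (\<lambda>x. Var (p x)) (\<theta>\<^sub>2 u)"
      unfolding subst_apply_eq_iff
    proof
      fix x assume "x \<in> vars_trm (\<theta>\<^sub>2 u)"
      with u have "x \<in> W" by (auto simp: W_def)
      then show "\<delta> x = Var (p x)" by (simp add: g p(3))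
    qed
    then show ?thesis using \<delta> u by simp
  qed
  then show "(\<theta>\<^sub>1, \<theta>\<^sub>2) \<in> subst_sim ar U"
    using S Var_bij_in_renamings[OF p(1,2)] unfolding subst_sim_def by blast
qed

lemma equiv_of_preorder:
  assumes "preorder_on A r"
  shows "equiv A (r \<inter> r\<inverse>)"
proof (rule equivI)
  show "r \<inter> r\<inverse> \<subseteq> A \<times> A" "refl_on A (r \<inter> r\<inverse>)"
    using assms by (auto simp: preorder_on_def refl_on_def)
  show "sym (r \<inter> r\<inverse>)" by (auto intro: symI)
  show "trans (r \<inter> r\<inverse>)"
    using assms by (auto simp: preorder_on_def intro: trans_Int)
qed

lemma equiv_subst_sim:
  assumes "finite U"
  shows "equiv (Subst ar) (subst_sim ar U)"
proof -
  have "preorder_on (Subst ar) (subst_le ar U)"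
    unfolding preorder_on_def
  proof (intro conjI)
    show "subst_le ar U \<subseteq> Subst ar \<times> Subst ar" by (auto simp: subst_le_def)
    show "refl_on (Subst ar) (subst_le ar U)" by (simp add: refl_on_def subst_le_refl)
    show "trans (subst_le ar U)" by (blast intro: transI subst_le_trans)
  qed
  with assms show ?thesis by (simp add: subst_sim_eq equiv_of_preorder)
qed

section \<open>E-substitutions and their extensions by the identity\<close>

definition extend :: "('v \<rightharpoonup> ('f, 'v) trm) \<Rightarrow> 'v \<Rightarrow> ('f, 'v) trm" where
  "extend \<sigma> x = (case \<sigma> x of None \<Rightarrow> Var x | Some s \<Rightarrow> s)"

lemma esubst_apply_extend: "esubst_apply \<sigma> = subst_apply (extend \<sigma>)"
  by (simp add: esubst_apply_def extend_def[abs_def])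

lemma extend_in_Subst:
  assumes "\<sigma> \<in> esubsts ar"
  shows "extend \<sigma> \<in> Subst ar"
proof -
  have "extend \<sigma> x \<in> terms ar" for x
    using assms by (auto simp: extend_def esubsts_def ran_def intro: terms.intros split: option.split)
  moreover have "{x. extend \<sigma> x \<noteq> Var x} \<subseteq> dom \<sigma>"
    by (auto simp: extend_def split: option.splits)
  ultimately show ?thesis
    using assms by (auto simp: Subst_def esubsts_def intro: finite_subset)
qed

text \<open>The partial map has domain exactly \<open>U\<close>, including variables that
  \<open>\<theta>\<close> fixes. It serves both with the support of \<open>\<theta>\<close> and with
  the variable set of a class in place of \<open>U\<close>.\<close>

lemma restrict_in_esubsts:
  "\<theta> \<in> Subst ar \<Longrightarrow> finite U \<Longrightarrow> (Some \<circ> \<theta>) |` U \<in> esubsts ar"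
  by (auto simp: esubsts_def Subst_def ran_def restrict_map_def dom_def split: if_splits)

lemma extend_restrict: "u \<in> U \<Longrightarrow> extend ((Some \<circ> \<theta>) |` U) u = \<theta> u"
  by (simp add: extend_def)

text \<open>Restriction to the finite support gives a preimage. The equation turns a quantifier over
  E-substitutions \<open>\<delta>\<close> into one over \<open>Subst ar\<close>.\<close>

lemma extend_image_esubsts:
  fixes ar :: "'f \<Rightarrow> nat"
  shows "extend ` esubsts ar = (Subst ar :: ('v \<Rightarrow> ('f, 'v) trm) set)" (is "?L = ?R")
proof
  show "?L \<subseteq> ?R" using extend_in_Subst by auto
  show "?R \<subseteq> ?L"
  proof
    fix \<theta> :: "'v \<Rightarrow> ('f, 'v) trm" assume \<theta>: "\<theta> \<in> Subst ar"
    let ?\<sigma> = "(Some \<circ> \<theta>) |` {x. \<theta> x \<noteq> Var x}"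
    have "?\<sigma> \<in> esubsts ar" using \<theta> by (intro restrict_in_esubsts) (auto simp: Subst_def)
    moreover have "extend ?\<sigma> = \<theta>" by (auto simp: extend_def restrict_map_def)
    ultimately show "\<theta> \<in> ?L" by force
  qed
qed

lemma term_with_vars:
  fixes ar :: "'f \<Rightarrow> nat" and U :: "'v set"
  assumes "ar c = 0" "ar f \<ge> 2" "finite U"
  shows "\<exists>t :: ('f, 'v) trm \<in> terms ar. vars_trm t = U"
  using assms(3)
proof induction
  case empty
  show ?case using terms.Fun[of "[]" ar c] assms(1) by force
next
  case (insert x U)
  then obtain t :: "('f, 'v) trm" where t: "t \<in> terms ar" "vars_trm t = U" by blast
  \<comment> \<open>As \<open>ar f\<close> is at least 2, filling the remaining argument places
    leaves at least one copy of \<open>t\<close>.\<close>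
  let ?t = "Fun f (Var x # replicate (ar f - 1) t)"
  have "?t \<in> terms ar" using assms(2) t by (intro terms.Fun) (auto intro: terms.Var)
  moreover have "vars_trm ?t = insert x U" using assms(2) t by auto
  ultimately show ?case by blast
qed

text \<open>A single term whose variables are exactly \<open>dom \<theta>\<close> provides one
  \<open>\<delta>\<close> for all of them; conversely, such a \<open>\<delta>\<close> serves every
  term with variables in \<open>dom \<theta>\<close>.\<close>

lemma esubst_le_iff:
  fixes ar :: "'f \<Rightarrow> nat"
  assumes "ar c = 0" "ar f \<ge> 2" and \<sigma>: "\<sigma> \<in> esubsts ar" and \<theta>: "\<theta> \<in> esubsts ar"
  shows "(\<sigma>, \<theta>) \<in> esubst_le ar \<longleftrightarrow>
    dom \<theta> \<subseteq> dom \<sigma> \<and> (extend \<sigma>, extend \<theta>) \<in> subst_le ar (dom \<theta>)"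
proof -
  have fin: "finite (dom \<theta>)" using \<theta> by (simp add: esubsts_def)
  \<comment> \<open>Equality of two instances of \<open>t\<close> amounts to agreement on its
    variables, so \<open>t\<close> matters only through its variable set.\<close>
  have ex: "(\<exists>\<delta> \<in> esubsts ar. esubst_apply \<sigma> t = esubst_apply \<delta> (esubst_apply \<theta> t)) \<longleftrightarrow>
      (\<exists>\<delta> \<in> Subst ar. \<forall>x \<in> vars_trm t. extend \<sigma> x = subst_apply \<delta> (extend \<theta> x))" for t
    unfolding extend_image_esubsts[symmetric]
    by (simp add: esubst_apply_extend subst_apply_subst_apply subst_apply_eq_iff)
  have "(\<forall>t \<in> terms ar. vars_trm t \<subseteq> dom \<theta> \<longrightarrow>
        (\<exists>\<delta> \<in> Subst ar. \<forall>x \<in> vars_trm t. extend \<sigma> x = subst_apply \<delta> (extend \<theta> x))) \<longleftrightarrow>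
      (\<exists>\<delta> \<in> Subst ar. \<forall>x \<in> dom \<theta>. extend \<sigma> x = subst_apply \<delta> (extend \<theta> x))"
    using term_with_vars[where ar = ar, OF assms(1,2) fin] by blast
  then show ?thesis
    using \<sigma> \<theta> by (simp add: esubst_le_def ex subst_le_def extend_in_Subst)
qed

section \<open>The isomorphism, on representatives and then on classes\<close>

theorem theorem8p1:
  fixes ar :: "'f \<Rightarrow> nat"
  assumes "infinite (UNIV :: 'v set)"
    and "\<exists>c. ar c = 0"
    and "\<exists>f. ar f \<ge> 2"
  shows "isomorphic_posets
           (ESubst ar :: ('v \<rightharpoonup> ('f, 'v) trm) set set) (ESubst_le ar)
           (Subst_sim ar :: ('v set \<times> ('v \<Rightarrow> ('f, 'v) trm) set) set) (Subst_sim_le ar)"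
proof -
  obtain c f where cf: "ar c = 0" "ar f \<ge> 2" using assms(2,3) by blast
  define A where "A = (esubsts ar :: ('v \<rightharpoonup> ('f, 'v) trm) set)"
  \<comment> \<open>\<open>B\<close> and \<open>s\<close> present \<open>Subst_sim\<close> by
    representatives tagged with a variable set. The tag \<open>dom \<sigma>\<close> in
    \<open>k\<close> is essential: \<open>extend\<close> alone cannot tell a variable mapped to
    itself from one outside the domain.\<close>
  define B where "B = {U :: 'v set. finite U} \<times> (Subst ar :: ('v \<Rightarrow> ('f, 'v) trm) set)"
  define s where "s = {((U, \<theta>), (V, \<theta>')) | U V \<theta> \<theta>'.
    finite (U :: 'v set) \<and> finite V \<and> U \<supseteq> V \<and> (\<theta> :: 'v \<Rightarrow> ('f, 'v) trm, \<theta>') \<in> subst_le ar V}"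
  define k where "k \<sigma> = (dom \<sigma>, extend \<sigma>)" for \<sigma> :: "'v \<rightharpoonup> ('f, 'v) trm"
  define cl where "cl \<sigma> = esubst_sim ar `` {\<sigma>}" for \<sigma> :: "'v \<rightharpoonup> ('f, 'v) trm"
  define d where "d = (\<lambda>(U :: 'v set, \<theta> :: 'v \<Rightarrow> ('f, 'v) trm). (U, subst_sim ar U `` {\<theta>}))"
  have s: "preorder_on B s"
    unfolding preorder_on_def
  proof (intro conjI)
    show "s \<subseteq> B \<times> B" by (auto simp: s_def B_def subst_le_def)
    show "refl_on B s" by (auto simp: s_def B_def refl_on_def subst_le_refl)
    show "trans s" by (rule transI) (fastforce simp: s_def intro: subst_le_trans)
  qed
  have r: "esubst_le ar \<subseteq> A \<times> A" by (auto simp: esubst_le_def A_def)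
  have kB: "k ` A \<subseteq> B" by (auto simp: k_def A_def B_def extend_in_Subst) (simp add: esubsts_def)
  have rs: "(x, y) \<in> esubst_le ar \<longleftrightarrow> (k x, k y) \<in> s" if "x \<in> A" "y \<in> A" for x y
    using that by (auto simp: A_def esubst_le_iff[where ar = ar, OF cf] k_def s_def esubsts_def)
  \<comment> \<open>By \<open>rs\<close>, \<open>esubst_le\<close> is the pullback of
    \<open>s\<close> along \<open>k\<close>, so reflexivity and transitivity are inherited instead
    of being checked term by term.\<close>
  have pr: "preorder_on A (esubst_le ar)"
    using s r kB rs by (rule preorder_on_pullback)
  then have "equiv A (esubst_sim ar)"
    unfolding esubst_sim_def by (rule equiv_of_preorder)
  then have cl: "cl x = cl y \<longleftrightarrow> (x, y) \<in> esubst_le ar \<and> (y, x) \<in> esubst_le ar"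
    if "x \<in> A" "y \<in> A" for x y
    using that by (simp add: cl_def eq_equiv_class_iff esubst_sim_def)
  \<comment> \<open>Comparability in both directions forces equal variable sets; then
    \<open>subst_sim_eq\<close> trades the two instantiations for a renaming.\<close>
  have d: "d x = d y \<longleftrightarrow> (x, y) \<in> s \<and> (y, x) \<in> s" if "x \<in> B" "y \<in> B" for x y
  proof -
    obtain U \<theta> V \<theta>' where xy: "x = (U, \<theta>)" "y = (V, \<theta>')" by fastforce
    have "subst_sim ar U `` {\<theta>} = subst_sim ar U `` {\<theta>'} \<longleftrightarrow> (\<theta>, \<theta>') \<in> subst_sim ar U"
      using that xy by (intro eq_equiv_class_iff[OF equiv_subst_sim]) (auto simp: B_def)
    then show ?thesis
      using that xy by (auto simp: d_def s_def B_def subst_sim_eq)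
  qed
  have surj: "\<exists>x \<in> A. d (k x) = d y" if "y \<in> B" for y
  proof -
    obtain U \<theta> where y: "y = (U, \<theta>)" by fastforce
    with that have U: "finite U" "\<theta> \<in> Subst ar" by (auto simp: B_def)
    \<comment> \<open>The extension of \<open>?\<sigma>\<close> agrees with \<open>\<theta>\<close>
      on \<open>U\<close> but may differ elsewhere, so only the classes coincide; the identity
      substitution witnesses both comparisons.\<close>
    let ?\<sigma> = "(Some \<circ> \<theta>) |` U"
    have \<sigma>: "?\<sigma> \<in> A" using U by (simp add: A_def restrict_in_esubsts)
    then have "extend ?\<sigma> \<in> Subst ar" by (simp add: A_def extend_in_Subst)
    then have "(extend ?\<sigma>, \<theta>) \<in> subst_le ar U" "(\<theta>, extend ?\<sigma>) \<in> subst_le ar U"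
      using U Var_in_Subst[of ar]
      by (auto simp: subst_le_def extend_restrict subst_apply_Var intro!: bexI[where x = Var])
    moreover have "k ?\<sigma> = (U, extend ?\<sigma>)" by (auto simp: k_def dom_def restrict_map_def)
    ultimately have "(k ?\<sigma>, y) \<in> s" "(y, k ?\<sigma>) \<in> s" using U y by (auto simp: s_def)
    with \<sigma> that kB show ?thesis using d by blast
  qed
  have "cl ` A = ESubst ar" by (auto simp: cl_def A_def ESubst_def quotient_def)
  moreover have "{(cl x, cl y) | x y. (x, y) \<in> esubst_le ar} = ESubst_le ar"
    by (simp add: ESubst_le_def cl_def)
  moreover have "d ` B = Subst_sim ar"
    by (auto simp: d_def B_def Subst_sim_def quotient_def)
  moreover have "{(d x, d y) | x y. (x, y) \<in> s} = Subst_sim_le ar"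
    unfolding Subst_sim_le_def s_def d_def by (rule set_eqI) (simp, blast)
  ultimately show ?thesis
    using isomorphic_posets_of_preorders[OF pr s kB rs cl d surj] by simp
qed

end
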